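(* Let $1\le j\le d$, $d\ge 2$. There exists a good subset basis (gsb) $\{s_1,\dots,s_j\}$ in $\mathbb{R}^{d+1}$ if and only if there exists a quasi-isotropic polytope $C=\operatorname{conv}\{u_1,\dots,u_{d+1}\}\subset\mathbb{R}^j$. Moreover, if a gsb $\{s_1,\dots,s_j\}$ and a quasi-isotropic polytope $C=\operatorname{conv}\{u_1,\dots,u_{d+1}\}$ correspond to each other via $s_{lk}=\sqrt{\frac{j}{d+1}}\,u_{k,l}$ ($1\le l\le j$, $1\le k\le d+1$), then the orthogonal projection of $T^d=\operatorname{conv}\{e_1,\dots,e_{d+1}\}\subset\mathbb{R}^{d+1}$ onto $\operatorname{span}\{s_1,\dots,s_j\}$ is similar to $C$.
   Context: Write $s_{lk}$ for the $k$-th coordinate of $s_l$ and $u_{k,l}$ for the $l$-th coordinate of $u_k$. A set of orthonormal vectors $\{s_1,\dots,s_j\}$ in $\mathbb{R}^{d+1}$, $1\le j\le d$, is a good subset basis (gsb) if $\sum_{k=1}^{d+1}s_{lk}=0$ for all $l\in\{1,\dots,j\}$ and $\sum_{l=1}^{j}s_{lk}^2=\frac{j}{d+1}$ for all $k\in\{1,\dots,d+1\}$. A polytope $C=\operatorname{conv}\{u_1,\dots,u_m\}\subset\mathbb{R}^j$ with all $u_i$ on the Euclidean unit sphere (the $u_i$ are not required to be distinct) is quasi-isotropic if $\sum_{i=1}^m \frac{j}{m}u_i=0$ and $\sum_{i=1}^m\frac{j}{m}\,u_i\otimes u_i=I^j$, where $u\otimes u=uu^T$ and $I^j$ is the $j\times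 j$ identity matrix. Two bodies are similar if one arises from the other by rotation, translation and dilatation; here $\operatorname{span}\{s_1,\dots,s_j\}$ is identified with $\mathbb{R}^j$ isometrically through the orthonormal basis $s_1,\dots,s_j$. *)

theory Defs
  imports "HOL-Analysis.Analysis"
begin

text \<open>Throughout, the dimensions are carried by finite index types: \<open>'j\<close> has \<open>j\<close> elements
  and \<open>'n\<close> has \<open>d + 1\<close> elements, so that \<open>s l $ k\<close> is the coordinate \<open>s_lk\<close> and \<open>u k $ l\<close>
  is the coordinate \<open>u_{k,l}\<close>.\<close>

text \<open>The set of vectors is given as a family; orthonormality makes the family injective.
  The restriction \<open>1 \<le> j \<le> d\<close> on the dimensions is left to the statements using this notion.\<close>

definition good_subset_basis :: "('j::finite \<Rightarrow> real^'n::finite) \<Rightarrow> bool" where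
  "good_subset_basis s \<longleftrightarrow>
     (\<forall>l. norm (s l) = 1) \<and>
     (\<forall>l l'. l \<noteq> l' \<longrightarrow> orthogonal (s l) (s l')) \<and>
     (\<forall>l. (\<Sum>k\<in>UNIV. s l $ k) = 0) \<and>
     (\<forall>k. (\<Sum>l\<in>UNIV. (s l $ k)\<^sup>2) = real CARD('j) / real CARD('n))"

definition outer_product :: "real^'j \<Rightarrow> real^'j \<Rightarrow> real^'j^'j" where
  "outer_product u v = (\<chi> a b. u $ a * v $ b)"

text \<open>The condition refers to the generating family \<open>u\<close>, which need not be injective,
  and not only to the polytope \<open>C\<close>.\<close>

definition quasi_isotropic :: "(real^'j::finite) set \<Rightarrow> ('m::finite \<Rightarrow> real^'j) \<Rightarrow> bool" where
  "quasi_isotropic C u \<longleftrightarrow>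
     C = convex hull (range u) \<and>
     (\<forall>i. u i \<in> sphere 0 1) \<and>
     (\<Sum>i\<in>UNIV. (real CARD('j) / real CARD('m)) *\<^sub>R u i) = 0 \<and>
     (\<Sum>i\<in>UNIV. (real CARD('j) / real CARD('m)) *\<^sub>R outer_product (u i) (u i)) = mat 1"

definition orthogonal_projection :: "'a::euclidean_space set \<Rightarrow> 'a \<Rightarrow> 'a" where
  "orthogonal_projection W x = (THE y. y \<in> W \<and> (\<forall>w\<in>W. orthogonal (x - y) w))"

definition standard_simplex :: "(real^'n::finite) set" where
  "standard_simplex = convex hull (range (\<lambda>k. axis k 1))"

text \<open>For orthonormal \<open>s\<close>, restricted to the span of the \<open>s l\<close>, this is the isometric
  identification of that span with \<open>real^'j\<close> sending \<open>s l\<close> to \<open>axis l 1\<close>.\<close>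

definition basis_coordinates :: "('j::finite \<Rightarrow> real^'n::finite) \<Rightarrow> real^'n \<Rightarrow> real^'j" where
  "basis_coordinates s x = (\<chi> l. x \<bullet> s l)"

text \<open>Rotations are proper (determinant 1). These maps form a group, so the relation is symmetric.\<close>

definition similar_bodies :: "(real^'j::finite) set \<Rightarrow> (real^'j) set \<Rightarrow> bool" where
  "similar_bodies A B \<longleftrightarrow>
     (\<exists>Q a c. rotation_matrix Q \<and> c > 0 \<and> B = (\<lambda>x. a + c *\<^sub>R (Q *v x)) ` A)"

end

theory Submission
  imports Defs
begin

text \<open>Up to the factor \<open>r = sqrt (j / (d + 1))\<close>, the vectors \<open>s l\<close> and \<open>u k\<close> are the rows and
  columns of one matrix: the row conditions of a gsb are the centring and isotropy conditions on
  the columns, and the gsb column condition says that the \<open>u k\<close> are unit vectors. The coordinates of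
  the projection of \<open>e_k\<close> are then those of \<open>r u k\<close>, so the projected simplex is \<open>r C\<close>.\<close>

text \<open>The definite description denotes: a point with these properties exists by orthogonal
  decomposition, and the difference of two such points lies in the span and is orthogonal to itself,
  hence is zero.\<close>

lemma orthogonal_projection_span:
  fixes x :: "'a::euclidean_space"
  shows "orthogonal_projection (span S) x \<in> span S"
    and "w \<in> span S \<Longrightarrow> orthogonal (x - orthogonal_projection (span S) x) w"
proof -
  obtain y z where y: "y \<in> span S" and z: "\<And>w. w \<in> span S \<Longrightarrow> orthogonal z w" and x: "x = y + z"
    using orthogonal_subspace_decomp_exists by blast
  have "orthogonal_projection (span S) x = y"
    unfolding orthogonal_projection_def
  proof (rule the_equality)
    show "y \<in> span S \<and> (\<forall>w\<in>span S. orthogonal (x - y) w)"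
      using y z x by simp
  next
    fix y' assume y': "y' \<in> span S \<and> (\<forall>w\<in>span S. orthogonal (x - y') w)"
    have d: "y' - y \<in> span S" using y y' span_diff by blast
    have "(x - y) \<bullet> (y' - y) = 0" "(x - y') \<bullet> (y' - y) = 0"
      using d y' z x by (auto simp: orthogonal_def)
    then have "(y' - y) \<bullet> (y' - y) = 0"
      by (simp add: inner_diff_left)
    then show "y' = y" by simp
  qed
  then show "orthogonal_projection (span S) x \<in> span S"
    and "w \<in> span S \<Longrightarrow> orthogonal (x - orthogonal_projection (span S) x) w"
    using y z x by auto
qed

text \<open>The residual of the projection is orthogonal to every generator \<open>s l\<close>, so
  inner products with \<open>s l\<close> do not see it.\<close>

lemma basis_coordinates_orthogonal_projection:
  "basis_coordinates s (orthogonal_projection (span (range s)) x) = basis_coordinates s x"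
proof -
  have "orthogonal (x - orthogonal_projection (span (range s)) x) (s l)" for l
    by (intro orthogonal_projection_span span_base) simp
  then show ?thesis
    by (simp add: basis_coordinates_def vec_eq_iff orthogonal_def inner_diff_left)
qed

lemma linear_basis_coordinates: "linear (basis_coordinates s)"
  by (rule linearI) (simp_all add: basis_coordinates_def vec_eq_iff inner_add_left)

lemma basis_coordinates_axis: "basis_coordinates s (axis k 1) = (\<chi> l. s l $ k)"
  by (simp add: basis_coordinates_def inner_axis')

text \<open>Stated for a fixed related pair, so that each direction of the existence claim follows
  by defining one family from the other.\<close>

lemma good_subset_basis_iff_quasi_isotropic:
  fixes s :: "'j::finite \<Rightarrow> real^'n::finite" and u :: "'n \<Rightarrow> real^'j"
  assumes su: "\<And>l k. s l $ k = sqrt (real CARD('j) / real CARD('n)) * u k $ l"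
  shows "good_subset_basis s \<longleftrightarrow> quasi_isotropic (convex hull (range u)) u"
proof -
  define q where "q = real CARD('j) / real CARD('n)"
  have q: "q > 0" by (simp add: q_def)
  have su': "s l $ k = sqrt q * u k $ l" for l k
    using su by (simp add: q_def)
  have sqrt_mult: "(sqrt q * x) * (sqrt q * y) = q * (x * y)" for x y
  proof -
    have "(sqrt q * x) * (sqrt q * y) = (sqrt q * sqrt q) * (x * y)"
      by (simp only: ac_simps)
    then show ?thesis using q by simp
  qed
  \<comment> \<open>The Gram entry of \<open>s l\<close> and \<open>s l'\<close> is exactly the
    entry at \<open>l\<close>, \<open>l'\<close> of the isotropy sum, so orthonormality says that
    this sum is the identity matrix.\<close>
  have inner: "s l \<bullet> s l' = (\<Sum>k\<in>UNIV. q * (u k $ l * u k $ l'))" for l l'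
    by (simp add: inner_vec_def su' sqrt_mult)
  have "(\<forall>l. norm (s l) = 1) \<and> (\<forall>l l'. l \<noteq> l' \<longrightarrow> orthogonal (s l) (s l'))
      \<longleftrightarrow> (\<forall>l l'. s l \<bullet> s l' = (if l = l' then 1 else 0))"
    by (auto simp: norm_eq_1 orthogonal_def)
  also have "\<dots> \<longleftrightarrow> (\<Sum>k\<in>UNIV. q *\<^sub>R outer_product (u k) (u k)) = mat 1"
    by (simp add: inner vec_eq_iff outer_product_def mat_def)
  finally have orthonormal: "(\<forall>l. norm (s l) = 1) \<and> (\<forall>l l'. l \<noteq> l' \<longrightarrow> orthogonal (s l) (s l'))
      \<longleftrightarrow> (\<Sum>k\<in>UNIV. q *\<^sub>R outer_product (u k) (u k)) = mat 1" .
  \<comment> \<open>In each coordinate \<open>l\<close> the two sides are \<open>sqrt q\<close> and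
    \<open>q\<close> times the same sum of the \<open>u k $ l\<close>, and both factors are
    nonzero.\<close>
  have centred: "(\<forall>l. (\<Sum>k\<in>UNIV. s l $ k) = 0) \<longleftrightarrow> (\<Sum>k\<in>UNIV. q *\<^sub>R u k) = 0"
    using q by (simp add: su' vec_eq_iff flip: sum_distrib_left)
  \<comment> \<open>Since \<open>q > 0\<close>, this column sum equals \<open>q\<close> exactly when
    \<open>u k\<close> has norm 1.\<close>
  have "(\<Sum>l\<in>UNIV. (s l $ k)\<^sup>2) = q * (u k \<bullet> u k)" for k
    by (simp add: su' inner_vec_def power2_eq_square sqrt_mult sum_distrib_left)
  then have unit: "(\<forall>k. (\<Sum>l\<in>UNIV. (s l $ k)\<^sup>2) = q) \<longleftrightarrow> (\<forall>k. u k \<in> sphere 0 1)"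
    using q by (simp add: norm_eq_1)
  show ?thesis
    unfolding good_subset_basis_def quasi_isotropic_def q_def [symmetric]
    using orthonormal centred unit by blast
qed

theorem lemma2p9:
  fixes j d :: nat
  assumes "CARD('j::finite) = j" and "CARD('n::finite) = d + 1"
    and "1 \<le> j" and "j \<le> d" and "2 \<le> d"
  shows "((\<exists>s :: 'j \<Rightarrow> real^'n. good_subset_basis s) \<longleftrightarrow>
          (\<exists>(C :: (real^'j) set) (u :: 'n \<Rightarrow> real^'j). quasi_isotropic C u)) \<and>
    (\<forall>(s :: 'j \<Rightarrow> real^'n) (C :: (real^'j) set) (u :: 'n \<Rightarrow> real^'j).
       good_subset_basis s \<longrightarrow> quasi_isotropic C u \<longrightarrow>
       (\<forall>l k. s l $ k = sqrt (real j / real (d + 1)) * u k $ l) \<longrightarrow>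
       similar_bodies
         (basis_coordinates s ` orthogonal_projection (span (range s)) ` standard_simplex) C)"
proof (intro conjI iffI allI impI)
  define r where "r = sqrt (real CARD('j) / real CARD('n))"
  have r: "r > 0" by (simp add: r_def)
  have r_eq: "r = sqrt (real j / real (d + 1))"
    using assms by (simp add: r_def)
  {
    assume "\<exists>s :: 'j \<Rightarrow> real^'n. good_subset_basis s"
    then obtain s :: "'j \<Rightarrow> real^'n" where s: "good_subset_basis s" ..
    define u :: "'n \<Rightarrow> real^'j" where "u k = (\<chi> l. s l $ k / r)" for k
    have "s l $ k = r * u k $ l" for l k
      using r by (simp add: u_def)
    then have "quasi_isotropic (convex hull (range u)) u"
      using s good_subset_basis_iff_quasi_isotropic unfolding r_def by blast
    then show "\<exists>(C :: (real^'j) set) (u :: 'n \<Rightarrow> real^'j). quasi_isotropic C u" by blast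
  next
    assume "\<exists>(C :: (real^'j) set) (u :: 'n \<Rightarrow> real^'j). quasi_isotropic C u"
    \<comment> \<open>The polytope \<open>C\<close> is determined by \<open>u\<close>, so it can be
      replaced by the hull.\<close>
    then obtain u :: "'n \<Rightarrow> real^'j" where u: "quasi_isotropic (convex hull (range u)) u"
      by (auto simp: quasi_isotropic_def)
    define s :: "'j \<Rightarrow> real^'n" where "s l = (\<chi> k. r * u k $ l)" for l
    have "s l $ k = r * u k $ l" for l k
      by (simp add: s_def)
    then have "good_subset_basis s"
      using u good_subset_basis_iff_quasi_isotropic unfolding r_def by blast
    then show "\<exists>s :: 'j \<Rightarrow> real^'n. good_subset_basis s" by blast
  next
    fix s :: "'j \<Rightarrow> real^'n" and C :: "(real^'j) set" and u :: "'n \<Rightarrow> real^'j"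
    assume "quasi_isotropic C u"
      and su: "\<forall>l k. s l $ k = sqrt (real j / real (d + 1)) * u k $ l"
    then have C: "C = convex hull (range u)"
      by (simp add: quasi_isotropic_def)
    have "basis_coordinates s (axis k 1) = r *\<^sub>R u k" for k
      using su by (simp add: basis_coordinates_axis vec_eq_iff r_eq)
    \<comment> \<open>Linear maps and scalings commute with convex hulls, so comparing the images of
      the vertices suffices.\<close>
    then have "basis_coordinates s ` standard_simplex = (*\<^sub>R) r ` C"
      unfolding standard_simplex_def C convex_hull_scaling [symmetric]
      by (simp add: convex_hull_linear_image [OF linear_basis_coordinates] image_image)
    moreover have "basis_coordinates s ` orthogonal_projection (span (range s)) ` X
        = basis_coordinates s ` X" for X
      by (simp only: image_image basis_coordinates_orthogonal_projection)
    \<comment> \<open>The similarity is a pure dilatation by \<open>inverse r\<close>: the rotation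
      is the identity and the translation is zero.\<close>
    ultimately have "C = (\<lambda>x. 0 + inverse r *\<^sub>R (mat 1 *v x)) `
        basis_coordinates s ` orthogonal_projection (span (range s)) ` standard_simplex"
      using r by (simp add: image_image)
    moreover have "rotation_matrix (mat 1 :: real^'j^'j)"
      by (simp add: rotation_matrix_def orthogonal_matrix_id)
    ultimately show "similar_bodies
        (basis_coordinates s ` orthogonal_projection (span (range s)) ` standard_simplex) C"
      unfolding similar_bodies_def using r positive_imp_inverse_positive by blast
  }
qed

end
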